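(* Let $r\ge 1$ be an integer and let $n_1,\dots,n_r,m_1,\dots,m_r$ be positive real numbers. Let $X_1,\dots,X_r$ be independent real random variables such that $X_j$ has the $\mathrm{Beta}(n_j,m_j)$ distribution for each $j=1,\dots,r$. Let $W=\langle W_1,\dots,W_r\rangle$ be a random vector with the $\mathrm{Dirichlet}(n_1+m_1,\dots,n_r+m_r)$ distribution, independent of $(X_1,\dots,X_r)$. Then the randomly weighted average $Z=\sum_{j=1}^{r}W_jX_j$ has the $\mathrm{Beta}\left(\sum_{j=1}^{r}n_j,\ \sum_{j=1}^{r}m_j\right)$ distribution.
   Context: For $p,q>0$, $\mathrm{Beta}(p,q)$ is the distribution on $(0,1)$ with density $\frac{\Gamma(p+q)}{\Gamma(p)\Gamma(q)}x^{p-1}(1-x)^{q-1}$. For $\alpha_1,\dots,\alpha_r>0$, $\mathrm{Dirichlet}(\alpha_1,\dots,\alpha_r)$ is the distribution of a random vector $\langle W_1,\dots,W_r\rangle$ with $W_j\ge 0$, $\sum_{j}W_j=1$, such that $(W_1,\dots,W_{r-1})$ has density $\frac{\Gamma(\alpha_1+\cdots+\alpha_r)}{\prod_{j}\Gamma(\alpha_j)}\prod_{j=1}^{r}w_j^{\alpha_j-1}$ on $\{w_1,\dots,w_{r-1}>0,\ \sum_{j<r}w_j<1\}$, where $w_r=1-\sum_{j<r}w_j$ (for $r=1$, $W_1=1$ almost surely). Randomly weighted average: for independent random variables $X_1,\dots,X_r$ and a Dirichlet distributed random vector $W=\langle W_1,\dots,W_r\rangle$ (with $\sum_j W_j=1$)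 that is independent of the $X_j$'s, the randomly weighted average of the $X_j$'s is $Z=\sum_{j=1}^{r}W_jX_j$. *)

theory Defs
  imports "HOL-Probability.Probability"
begin

definition beta_density :: "real \<Rightarrow> real \<Rightarrow> real \<Rightarrow> real" where
  "beta_density p q x =
     (if 0 < x \<and> x < 1
      then Gamma (p + q) / (Gamma p * Gamma q) * x powr (p - 1) * (1 - x) powr (q - 1)
      else 0)"

text \<open>
  The joint density of the first \<open>r - 1\<close> coordinates of a Dirichlet vector indexed by
  \<open>{1..r}\<close>; the factor for \<open>j = r\<close> is split off because its base is the dependent
  coordinate \<open>1 - (\<Sum>j\<in>{1..<r}. w j)\<close>.
\<close>

definition dirichlet_density :: "nat \<Rightarrow> (nat \<Rightarrow> real) \<Rightarrow> (nat \<Rightarrow> real) \<Rightarrow> real" where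
  "dirichlet_density r \<alpha> w =
     (if (\<forall>j\<in>{1..<r}. 0 < w j) \<and> (\<Sum>j\<in>{1..<r}. w j) < 1
      then Gamma (\<Sum>j\<in>{1..r}. \<alpha> j) / (\<Prod>j\<in>{1..r}. Gamma (\<alpha> j))
           * (\<Prod>j\<in>{1..<r}. w j powr (\<alpha> j - 1))
           * (1 - (\<Sum>j\<in>{1..<r}. w j)) powr (\<alpha> r - 1)
      else 0)"

text \<open>
  For \<open>r = 1\<close> the density condition lives on the one-point space
  \<open>Pi\<^sub>M {} (\<lambda>_. lborel)\<close> and imposes no constraint (when \<open>\<alpha> 1 > 0\<close>), so only
  \<open>W 1 = 1\<close> almost surely remains.
\<close>

definition dirichlet_distributed ::
  "'a measure \<Rightarrow> nat \<Rightarrow> (nat \<Rightarrow> real) \<Rightarrow> (nat \<Rightarrow> 'a \<Rightarrow> real) \<Rightarrow> bool" where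
  "dirichlet_distributed M r \<alpha> W \<longleftrightarrow>
     (\<forall>j\<in>{1..r}. W j \<in> borel_measurable M) \<and>
     (AE \<omega> in M. (\<forall>j\<in>{1..r}. 0 \<le> W j \<omega>) \<and> (\<Sum>j\<in>{1..r}. W j \<omega>) = 1) \<and>
     distributed M (Pi\<^sub>M {1..<r} (\<lambda>_. lborel)) (\<lambda>\<omega>. \<lambda>j\<in>{1..<r}. W j \<omega>)
       (\<lambda>w. ennreal (dirichlet_density r \<alpha> w))"

end

theory Submission imports Defs begin

text \<open>
  Write \<open>k\<^sub>a(x) = x\<^bsup>a-1\<^esup> / \<Gamma>(a)\<close> for \<open>x > 0\<close>. Splitting a mass \<open>w\<close> with weight
  \<open>k\<^bsub>p+q\<^esub>(w)\<close> into \<open>u = w y\<close> and \<open>w - u\<close> with \<open>y\<close> distributed as \<open>Beta(p, q)\<close> gives the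
  weight \<open>k\<^sub>p(u) k\<^sub>q(w - u)\<close>, and the kernels form a convolution semigroup,
  \<open>k\<^sub>a * k\<^sub>b = k\<^bsub>a+b\<^esub>\<close>. The Dirichlet density is \<open>\<Gamma>(\<Sum>\<alpha>(j)) \<Prod> k\<^bsub>\<alpha>(j)\<^esub>(w\<^sub>j)\<close> on the simplex of total
  mass 1, so after splitting every \<open>w\<^sub>j\<close> according to \<open>X\<^sub>j\<close> the parts
  \<open>w\<^sub>j X\<^sub>j\<close> and the parts \<open>w\<^sub>j (1 - X\<^sub>j)\<close> recombine separately, and \<open>Z\<close> has
  density \<open>\<Gamma>(a + b) k\<^sub>a(z) k\<^sub>b(1 - z)\<close> with \<open>a = \<Sum>n\<^sub>j\<close> and \<open>b = \<Sum>m\<^sub>j\<close>.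
\<close>

section \<open>Gamma-type kernels and their convolution\<close>

text \<open>Up to the factor exp(-x) this is the Gamma(a, 1) density; on a fixed total mass the
  exponentials would multiply to a constant. Vanishing off the positive half-line encodes the
  simplex constraints inside the kernels, and values in \<open>ennreal\<close> let Tonelli apply
  without integrability conditions.\<close>

definition power_kernel :: "real \<Rightarrow> real \<Rightarrow> ennreal" where
  "power_kernel a x = (if 0 < x then ennreal (x powr (a - 1) / Gamma a) else 0)"

lemma measurable_power_kernel [measurable]: "power_kernel a \<in> borel_measurable borel"
  unfolding power_kernel_def by measurable

lemma measurable_beta_density [measurable]: "beta_density p q \<in> borel_measurable borel"
  unfolding beta_density_def by measurable

text \<open>The locale \<open>product_sigma_finite\<close> quantifies over every index, also those
  outside the index set in use, where the parameters may have any sign. A real-valued density over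
  \<open>lborel\<close> is finite everywhere, and this already gives sigma-finiteness.\<close>

lemma product_sigma_finite_beta:
  "product_sigma_finite (\<lambda>j. density lborel (\<lambda>x. ennreal (beta_density (p j) (q j) x)))"
  unfolding product_sigma_finite_def
  by (intro allI sigma_finite_measure.sigma_finite_iff_density_finite[OF sigma_finite_lborel, THEN iffD2]) auto

lemma nn_integral_beta_density:
  assumes "p > 0" "q > 0"
  shows "(\<integral>\<^sup>+x. ennreal (beta_density p q x) \<partial>lborel) = 1"
proof -
  \<comment> \<open>The open interval in \<open>beta_density\<close> and the closed one here agree
    at the endpoints as well, because \<open>0 powr y = 0\<close>.\<close>
  have eq: "ennreal (beta_density p q x) =
      ennreal (1 / Beta p q) * (ennreal (x powr (p - 1) * (1 - x) powr (q - 1)) * indicator {0..1} x)" for x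
    using assms
    by (auto simp: beta_density_def Beta_def indicator_def ennreal_mult[symmetric] field_simps)
  have B: "Beta p q > 0"
    using assms by (simp add: Beta_def Gamma_real_pos)
  have "(\<integral>\<^sup>+x. ennreal (x powr (p - 1) * (1 - x) powr (q - 1)) * indicator {0..1} x \<partial>lborel)
      = ennreal (Beta p q)"
    by (rule nn_integral_has_integral_lebesgue') (use assms in \<open>auto intro: has_integral_Beta_real\<close>)
  then show ?thesis
    unfolding eq using B by (simp add: nn_integral_cmult ennreal_mult[symmetric])
qed

text \<open>Substitution \<open>u = s * y\<close> turns a mass \<open>s\<close> split by a Beta
  variable \<open>y\<close> into the two parts \<open>u\<close> and \<open>s - u\<close>. For
  \<open>s \<le> 0\<close> the two parts cannot both be positive, so both sides vanish. The test
  function \<open>g\<close> keeps track of the first part.\<close>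

lemma power_kernel_beta_density:
  assumes "p > 0" "q > 0" and [measurable]: "g \<in> borel_measurable borel"
  shows "power_kernel (p + q) s * (\<integral>\<^sup>+y. ennreal (beta_density p q y) * g (s * y) \<partial>lborel)
    = (\<integral>\<^sup>+u. power_kernel p u * power_kernel q (s - u) * g u \<partial>lborel)"
proof (cases "s > 0")
  case True
  \<comment> \<open>The extra factor \<open>s\<close> on the right is the Jacobian of
    \<open>u = s * y\<close>; it comes from comparing the exponent \<open>p + q - 1\<close> with
    \<open>(p - 1) + (q - 1)\<close>.\<close>
  have pt: "power_kernel (p + q) s * ennreal (beta_density p q y)
      = ennreal s * (power_kernel p (s * y) * power_kernel q (s - s * y))" for y
  proof (cases "0 < y \<and> y < 1")
    case y: True
    have "s - s * y = s * (1 - y)" by (simp add: algebra_simps)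
    moreover have "s powr (p + q - 1) = s * (s powr (p - 1) * s powr (q - 1))"
      using True by (simp add: powr_add powr_diff)
    moreover have "Gamma (p + q) > 0" "Gamma p > 0" "Gamma q > 0"
      using assms by (auto intro: Gamma_real_pos)
    ultimately show ?thesis
      using True y
      by (simp add: power_kernel_def beta_density_def ennreal_mult[symmetric] powr_mult)
  next
    case False
    then have "\<not> s * y > 0 \<or> \<not> s - s * y > 0"
      using True by (auto simp: zero_less_mult_iff)
    with False show ?thesis by (auto simp: power_kernel_def beta_density_def)
  qed
  have "power_kernel (p + q) s * (\<integral>\<^sup>+y. ennreal (beta_density p q y) * g (s * y) \<partial>lborel)
     = (\<integral>\<^sup>+y. (power_kernel (p + q) s * ennreal (beta_density p q y)) * g (s * y) \<partial>lborel)"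
    by (subst nn_integral_cmult[symmetric]) (auto simp: mult.assoc)
  also have "\<dots> = ennreal s *
      (\<integral>\<^sup>+y. power_kernel p (s * y) * power_kernel q (s - s * y) * g (s * y) \<partial>lborel)"
    unfolding pt by (subst nn_integral_cmult[symmetric]) (auto simp: mult.assoc)
  also have "\<dots> = (\<integral>\<^sup>+u. power_kernel p u * power_kernel q (s - u) * g u \<partial>lborel)"
    using True by (subst nn_integral_real_affine[where c = s and t = 0]) auto
  finally show ?thesis .
next
  case False
  then have "power_kernel p u * power_kernel q (s - u) = 0" for u
    by (auto simp: power_kernel_def)
  moreover have "power_kernel (p + q) s = 0"
    using False by (simp add: power_kernel_def)
  ultimately show ?thesis by (simp only: mult_zero_left nn_integral_const)
qed

text \<open>With the constant test function 1 the Beta variable integrates out to total mass one,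
  which leaves the semigroup law.\<close>

lemma power_kernel_convolution:
  assumes "p > 0" "q > 0"
  shows "(\<integral>\<^sup>+u. power_kernel p u * power_kernel q (s - u) \<partial>lborel) = power_kernel (p + q) s"
  using power_kernel_beta_density[OF assms, of "\<lambda>_. 1" s] nn_integral_beta_density[OF assms] by simp

text \<open>The semigroup law in test-function form, obtained by translating
  \<open>v = z - u\<close> and exchanging the integrals. It merges two parts when only their sum
  matters.\<close>

lemma nn_integral_power_kernel_add:
  assumes "p > 0" "q > 0" and [measurable]: "h \<in> borel_measurable borel"
  shows "(\<integral>\<^sup>+u. \<integral>\<^sup>+v. power_kernel p u * power_kernel q v * h (u + v) \<partial>lborel \<partial>lborel)
    = (\<integral>\<^sup>+z. power_kernel (p + q) z * h z \<partial>lborel)"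
proof -
  have "(\<integral>\<^sup>+u. \<integral>\<^sup>+v. power_kernel p u * power_kernel q v * h (u + v) \<partial>lborel \<partial>lborel)
      = (\<integral>\<^sup>+u. \<integral>\<^sup>+z. power_kernel p u * power_kernel q (z - u) * h z \<partial>lborel \<partial>lborel)"
  proof (rule nn_integral_cong)
    fix u :: real
    show "(\<integral>\<^sup>+v. power_kernel p u * power_kernel q v * h (u + v) \<partial>lborel)
        = (\<integral>\<^sup>+z. power_kernel p u * power_kernel q (z - u) * h z \<partial>lborel)"
      by (subst (2) nn_integral_real_affine[where c = 1 and t = u]) auto
  qed
  also have "\<dots> = (\<integral>\<^sup>+z. \<integral>\<^sup>+u. power_kernel p u * power_kernel q (z - u) * h z \<partial>lborel \<partial>lborel)"
    by (rule lborel_pair.Fubini') measurable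
  also have "\<dots> = (\<integral>\<^sup>+z. power_kernel (p + q) z * h z \<partial>lborel)"
    by (simp add: nn_integral_multc power_kernel_convolution assms)
  finally show ?thesis .
qed

section \<open>Integrating out the weights and variables one index at a time\<close>

text \<open>Serves the induction on the index set: both coordinates at \<open>i\<close> must be
  fixed outside before the induction hypothesis can be applied to the double integral over
  \<open>I\<close>.\<close>

lemma nn_integral_PiM_insert_pair:
  assumes "product_sigma_finite M" "product_sigma_finite N" and I: "finite I" "i \<notin> I"
    and [measurable]: "case_prod F \<in> borel_measurable (Pi\<^sub>M (insert i I) M \<Otimes>\<^sub>M Pi\<^sub>M (insert i I) N)"
  shows "(\<integral>\<^sup>+w. \<integral>\<^sup>+x. F w x \<partial>Pi\<^sub>M (insert i I) N \<partial>Pi\<^sub>M (insert i I) M)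
    = (\<integral>\<^sup>+w'. \<integral>\<^sup>+x'. \<integral>\<^sup>+w. \<integral>\<^sup>+x. F (w(i := w')) (x(i := x')) \<partial>Pi\<^sub>M I N \<partial>Pi\<^sub>M I M \<partial>N i \<partial>M i)"
proof -
  interpret M: product_sigma_finite M by fact
  interpret N: product_sigma_finite N by fact
  interpret MI: sigma_finite_measure "Pi\<^sub>M I M" by (rule M.sigma_finite) fact
  interpret NI: sigma_finite_measure "Pi\<^sub>M I N" by (rule N.sigma_finite) fact
  interpret NI': sigma_finite_measure "Pi\<^sub>M (insert i I) N" by (rule N.sigma_finite) (simp add: I)
  interpret Ni: sigma_finite_measure "N i" by (rule N.sigma_finite_measures)
  interpret P: pair_sigma_finite "Pi\<^sub>M I M" "N i" by standard
  have "(\<integral>\<^sup>+w. \<integral>\<^sup>+x. F w x \<partial>Pi\<^sub>M (insert i I) N \<partial>Pi\<^sub>M (insert i I) M)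
    = (\<integral>\<^sup>+w'. \<integral>\<^sup>+w. \<integral>\<^sup>+x. F (w(i := w')) x \<partial>Pi\<^sub>M (insert i I) N \<partial>Pi\<^sub>M I M \<partial>M i)"
    by (rule M.product_nn_integral_insert_rev[OF I]) measurable
  also have "\<dots> = (\<integral>\<^sup>+w'. \<integral>\<^sup>+w. \<integral>\<^sup>+x'. \<integral>\<^sup>+x. F (w(i := w')) (x(i := x')) \<partial>Pi\<^sub>M I N \<partial>N i \<partial>Pi\<^sub>M I M \<partial>M i)"
    by (intro nn_integral_cong N.product_nn_integral_insert_rev[OF I]) measurable
  \<comment> \<open>The only genuine exchange: the variable at \<open>i\<close> moves outward past
    the remaining weights.\<close>
  also have "\<dots> = (\<integral>\<^sup>+w'. \<integral>\<^sup>+x'. \<integral>\<^sup>+w. \<integral>\<^sup>+x. F (w(i := w')) (x(i := x')) \<partial>Pi\<^sub>M I N \<partial>Pi\<^sub>M I M \<partial>N i \<partial>M i)"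
    by (intro nn_integral_cong P.Fubini'[symmetric]) measurable
  finally show ?thesis .
qed


text \<open>
  The shifts \<open>s\<close> (remaining mass) and \<open>t\<close> (sum accumulated so far) make the statement inductive
  in \<open>I\<close>; the parameters \<open>p, q\<close> belong to the coordinate determined by the others.
\<close>

lemma beta_weighted_sum_kernel:
  fixes n m :: "nat \<Rightarrow> real" and p q s t :: real
  assumes "finite I" and "\<And>j. j \<in> I \<Longrightarrow> n j > 0" and "\<And>j. j \<in> I \<Longrightarrow> m j > 0"
    and "p > 0" "q > 0" and [measurable]: "g \<in> borel_measurable borel"
  shows "(\<integral>\<^sup>+w. \<integral>\<^sup>+x. (\<Prod>j\<in>I. power_kernel (n j + m j) (w j)) *
        (power_kernel (p + q) (s - (\<Sum>j\<in>I. w j)) *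
          (\<integral>\<^sup>+y. ennreal (beta_density p q y) *
             g (t + (\<Sum>j\<in>I. w j * x j) + (s - (\<Sum>j\<in>I. w j)) * y) \<partial>lborel))
        \<partial>Pi\<^sub>M I (\<lambda>j. density lborel (\<lambda>x. ennreal (beta_density (n j) (m j) x)))
        \<partial>Pi\<^sub>M I (\<lambda>_. lborel))
    = (\<integral>\<^sup>+z. power_kernel (p + (\<Sum>j\<in>I. n j)) z *
        (power_kernel (q + (\<Sum>j\<in>I. m j)) (s - z) * g (t + z)) \<partial>lborel)"
  using assms(1-3)
proof (induction I arbitrary: s t rule: finite_induct)
  case empty
  \<comment> \<open>Both product spaces are one-point spaces, so only the dependent coordinate
    remains, and splitting its mass \<open>s\<close> is the kernel identity for the translate of
    \<open>g\<close> by \<open>t\<close>.\<close>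
  show ?case
    using power_kernel_beta_density[of p q "\<lambda>u. g (t + u)" s] assms(4,5)
    by (simp add: PiM_empty nn_integral_count_space_finite mult.assoc)
next
  case (insert i I)
  define N where "N j = density lborel (\<lambda>x. ennreal (beta_density (n j) (m j) x))" for j
  \<comment> \<open>\<open>P\<close> and \<open>Q\<close> are the parameters of the merged first and
    second parts of the dependent coordinate and of all indices in \<open>I\<close>.\<close>
  define P where "P = p + (\<Sum>j\<in>I. n j)"
  define Q where "Q = q + (\<Sum>j\<in>I. m j)"
  define F where "F J s t w x = (\<Prod>j\<in>J. power_kernel (n j + m j) (w j)) *
        (power_kernel (p + q) (s - (\<Sum>j\<in>J. w j)) *
          (\<integral>\<^sup>+y. ennreal (beta_density p q y) *
             g (t + (\<Sum>j\<in>J. w j * x j) + (s - (\<Sum>j\<in>J. w j)) * y) \<partial>lborel))"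
    for J s t and w x :: "nat \<Rightarrow> real"
  have sets_N [measurable_cong]: "sets (N j) = sets borel" for j
    by (simp add: N_def)
  have M: "product_sigma_finite (\<lambda>_::nat. lborel :: real measure)"
    by (standard)
  have N: "product_sigma_finite N"
    unfolding N_def[abs_def] by (rule product_sigma_finite_beta)
  have ni: "n i > 0" "m i > 0" and PQ: "P > 0" "Q > 0"
    unfolding P_def Q_def using insert.prems assms(4,5)
    by (auto intro!: add_pos_nonneg intro: sum_nonneg less_imp_le)
  have sum_upd: "(\<Sum>j\<in>insert i I. (w(i := w')) j) = w' + (\<Sum>j\<in>I. w j)"
    "(\<Sum>j\<in>insert i I. (w(i := w')) j * (x(i := x')) j) = w' * x' + (\<Sum>j\<in>I. w j * x j)"
    "(\<Prod>j\<in>insert i I. power_kernel (n j + m j) ((w(i := w')) j)) =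
       power_kernel (n i + m i) w' * (\<Prod>j\<in>I. power_kernel (n j + m j) (w j))"
    for w w' x x'
    using insert.hyps by (auto simp: intro!: sum.cong prod.cong arg_cong2[where f = "(+)"] arg_cong2[where f = "(*)"])
  interpret NI: sigma_finite_measure "Pi\<^sub>M I N"
    by (rule product_sigma_finite.sigma_finite[OF N]) (rule insert.hyps)
  have F_measurable [measurable]:
    "case_prod (F J s' t') \<in> borel_measurable (Pi\<^sub>M J (\<lambda>_. lborel) \<Otimes>\<^sub>M Pi\<^sub>M J N)" for J s' t'
    unfolding F_def by measurable
  \<comment> \<open>Once weight \<open>w'\<close> and variable \<open>x'\<close> at \<open>i\<close>
    are fixed, the remaining mass is \<open>s - w'\<close> and the accumulated sum
    \<open>t + w' * x'\<close>; the induction hypothesis is used at these shifts.\<close>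
  have inner: "(\<integral>\<^sup>+w. \<integral>\<^sup>+x. F (insert i I) s t (w(i := w')) (x(i := x')) \<partial>Pi\<^sub>M I N \<partial>Pi\<^sub>M I (\<lambda>_. lborel))
      = power_kernel (n i + m i) w' *
        (\<integral>\<^sup>+z. power_kernel P z * (power_kernel Q (s - w' - z) * g (t + w' * x' + z)) \<partial>lborel)"
    for w' x'
  proof -
    have "F (insert i I) s t (w(i := w')) (x(i := x'))
        = power_kernel (n i + m i) w' * F I (s - w') (t + w' * x') w x" for w x
      unfolding F_def sum_upd by (simp add: algebra_simps)
    then have "(\<integral>\<^sup>+w. \<integral>\<^sup>+x. F (insert i I) s t (w(i := w')) (x(i := x')) \<partial>Pi\<^sub>M I N \<partial>Pi\<^sub>M I (\<lambda>_. lborel))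
      = (\<integral>\<^sup>+w. power_kernel (n i + m i) w' *
          (\<integral>\<^sup>+x. F I (s - w') (t + w' * x') w x \<partial>Pi\<^sub>M I N) \<partial>Pi\<^sub>M I (\<lambda>_. lborel))"
      by (auto intro!: nn_integral_cong nn_integral_cmult)
    also have "\<dots> = power_kernel (n i + m i) w' *
        (\<integral>\<^sup>+w. \<integral>\<^sup>+x. F I (s - w') (t + w' * x') w x \<partial>Pi\<^sub>M I N \<partial>Pi\<^sub>M I (\<lambda>_. lborel))"
      by (rule nn_integral_cmult) measurable
    also have "(\<integral>\<^sup>+w. \<integral>\<^sup>+x. F I (s - w') (t + w' * x') w x \<partial>Pi\<^sub>M I N \<partial>Pi\<^sub>M I (\<lambda>_. lborel))
      = (\<integral>\<^sup>+z. power_kernel P z * (power_kernel Q (s - w' - z) * g (t + w' * x' + z)) \<partial>lborel)"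
      unfolding F_def P_def Q_def N_def by (rule insert.IH) (use insert.prems in auto)
    finally show ?thesis .
  qed
  have "(\<integral>\<^sup>+w. \<integral>\<^sup>+x. F (insert i I) s t w x \<partial>Pi\<^sub>M (insert i I) N \<partial>Pi\<^sub>M (insert i I) (\<lambda>_. lborel))
      = (\<integral>\<^sup>+w. \<integral>\<^sup>+x. power_kernel (n i + m i) w *
        (\<integral>\<^sup>+z. power_kernel P z * (power_kernel Q (s - w - z) * g (t + w * x + z)) \<partial>lborel)
        \<partial>N i \<partial>lborel)"
    by (subst nn_integral_PiM_insert_pair[OF M N insert.hyps(1,2)]) (simp_all add: inner)
  \<comment> \<open>The weight \<open>w\<close> at \<open>i\<close> is split into
    \<open>u = w * x\<close> and \<open>w - u\<close>, with kernels of parameters \<open>n i\<close>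
    and \<open>m i\<close>.\<close>
  also have "\<dots> = (\<integral>\<^sup>+w. \<integral>\<^sup>+u. power_kernel (n i) u * power_kernel (m i) (w - u) *
        (\<integral>\<^sup>+z. power_kernel P z * (power_kernel Q (s - w - z) * g (t + u + z)) \<partial>lborel)
        \<partial>lborel \<partial>lborel)"
  proof (rule nn_integral_cong)
    fix w :: real
    show "(\<integral>\<^sup>+x. power_kernel (n i + m i) w *
        (\<integral>\<^sup>+z. power_kernel P z * (power_kernel Q (s - w - z) * g (t + w * x + z)) \<partial>lborel) \<partial>N i)
      = (\<integral>\<^sup>+u. power_kernel (n i) u * power_kernel (m i) (w - u) *
        (\<integral>\<^sup>+z. power_kernel P z * (power_kernel Q (s - w - z) * g (t + u + z)) \<partial>lborel) \<partial>lborel)"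
      unfolding N_def
      by (subst power_kernel_beta_density[symmetric]) (auto simp: ni nn_integral_density nn_integral_cmult)
  qed
  \<comment> \<open>The factors are grouped by whether they depend on \<open>w\<close>: apart from
    \<open>m i\<close> and \<open>Q\<close>, nothing does. The two exchanges that follow make the
    \<open>w\<close>-integral innermost.\<close>
  also have "\<dots> = (\<integral>\<^sup>+w. \<integral>\<^sup>+u. \<integral>\<^sup>+z. (power_kernel (n i) u * power_kernel P z * g (t + u + z)) *
        (power_kernel (m i) (w - u) * power_kernel Q (s - w - z)) \<partial>lborel \<partial>lborel \<partial>lborel)"
    by (intro nn_integral_cong, subst nn_integral_cmult[symmetric])
       (auto simp: mult_ac intro!: nn_integral_cong)
  also have "\<dots> = (\<integral>\<^sup>+u. \<integral>\<^sup>+w. \<integral>\<^sup>+z. (power_kernel (n i) u * power_kernel P z * g (t + u + z)) *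
        (power_kernel (m i) (w - u) * power_kernel Q (s - w - z)) \<partial>lborel \<partial>lborel \<partial>lborel)"
    by (rule lborel_pair.Fubini') measurable
  also have "\<dots> = (\<integral>\<^sup>+u. \<integral>\<^sup>+z. \<integral>\<^sup>+w. (power_kernel (n i) u * power_kernel P z * g (t + u + z)) *
        (power_kernel (m i) (w - u) * power_kernel Q (s - w - z)) \<partial>lborel \<partial>lborel \<partial>lborel)"
    by (rule nn_integral_cong, rule lborel_pair.Fubini') measurable
  \<comment> \<open>After the translation \<open>v = w - u\<close>, the \<open>w\<close>-integral
    convolves the second part at \<open>i\<close> with the merged second parts; their total is
    \<open>s - (u + z)\<close>.\<close>
  also have "\<dots> = (\<integral>\<^sup>+u. \<integral>\<^sup>+z. power_kernel (n i) u * power_kernel P z *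
        (power_kernel (m i + Q) (s - (u + z)) * g (t + (u + z))) \<partial>lborel \<partial>lborel)"
  proof (intro nn_integral_cong)
    fix u z :: real
    have "(\<integral>\<^sup>+w. power_kernel (m i) (w - u) * power_kernel Q (s - w - z) \<partial>lborel)
        = (\<integral>\<^sup>+v. power_kernel (m i) v * power_kernel Q (s - (u + z) - v) \<partial>lborel)"
      by (subst nn_integral_real_affine[where c = 1 and t = u]) (auto simp: algebra_simps)
    then have conv: "(\<integral>\<^sup>+w. power_kernel (m i) (w - u) * power_kernel Q (s - w - z) \<partial>lborel)
        = power_kernel (m i + Q) (s - (u + z))"
      by (simp add: power_kernel_convolution ni PQ)
    show "(\<integral>\<^sup>+w. (power_kernel (n i) u * power_kernel P z * g (t + u + z)) *
        (power_kernel (m i) (w - u) * power_kernel Q (s - w - z)) \<partial>lborel)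
      = power_kernel (n i) u * power_kernel P z *
        (power_kernel (m i + Q) (s - (u + z)) * g (t + (u + z)))"
      by (subst nn_integral_cmult) (auto simp: conv mult_ac add.assoc)
  qed
  \<comment> \<open>The rest of the integrand depends on \<open>u\<close> and \<open>z\<close> only
    through \<open>u + z\<close>, so the first parts merge too.\<close>
  also have "\<dots> = (\<integral>\<^sup>+z. power_kernel (n i + P) z *
        (power_kernel (m i + Q) (s - z) * g (t + z)) \<partial>lborel)"
    by (rule nn_integral_power_kernel_add) (auto simp: ni PQ)
  finally show ?case
    using insert.hyps by (simp add: F_def N_def[abs_def] P_def Q_def add_ac)
qed


section \<open>Dirichlet and Beta densities in terms of kernels\<close>

text \<open>Each \<open>Gamma (\<alpha> j)\<close> of the normalising constant goes into its own
  kernel, and only the Gamma factor of the total stays outside. Outside the simplex some kernel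
  vanishes, and with it the product.\<close>

lemma dirichlet_density_power_kernel:
  assumes "r \<ge> 1" and "\<And>j. j \<in> {1..r} \<Longrightarrow> \<alpha> j > 0"
  shows "ennreal (dirichlet_density r \<alpha> w) = ennreal (Gamma (\<Sum>j\<in>{1..r}. \<alpha> j)) *
    ((\<Prod>j\<in>{1..<r}. power_kernel (\<alpha> j) (w j)) * power_kernel (\<alpha> r) (1 - (\<Sum>j\<in>{1..<r}. w j)))"
proof (cases "(\<forall>j\<in>{1..<r}. 0 < w j) \<and> (\<Sum>j\<in>{1..<r}. w j) < 1")
  case True
  have r: "{1..r} = insert r {1..<r}" using assms(1) by auto
  have pos: "(\<Sum>j\<in>{1..r}. \<alpha> j) > 0"
    using assms by (intro sum_pos) auto
  have "(\<Prod>j\<in>{1..<r}. power_kernel (\<alpha> j) (w j))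
      = (\<Prod>j\<in>{1..<r}. ennreal (w j powr (\<alpha> j - 1) / Gamma (\<alpha> j)))"
    using True by (intro prod.cong) (auto simp: power_kernel_def)
  also have "\<dots> = ennreal (\<Prod>j\<in>{1..<r}. w j powr (\<alpha> j - 1) / Gamma (\<alpha> j))"
    using assms by (intro prod_ennreal) auto
  finally have prod: "(\<Prod>j\<in>{1..<r}. power_kernel (\<alpha> j) (w j))
    = ennreal ((\<Prod>j\<in>{1..<r}. w j powr (\<alpha> j - 1)) / (\<Prod>j\<in>{1..<r}. Gamma (\<alpha> j)))"
    by (simp add: prod_dividef)
  have nn: "(\<Prod>j\<in>{1..<r}. w j powr (\<alpha> j - 1)) \<ge> 0" "(\<Prod>j\<in>{1..<r}. Gamma (\<alpha> j)) > 0"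
      "Gamma (\<alpha> r) > 0" "Gamma (\<Sum>j\<in>{1..r}. \<alpha> j) > 0"
    using assms pos by (auto intro!: prod_nonneg prod_pos)
  moreover have "(\<Prod>j\<in>{1..r}. Gamma (\<alpha> j)) = Gamma (\<alpha> r) * (\<Prod>j\<in>{1..<r}. Gamma (\<alpha> j))"
    unfolding r by simp
  ultimately show ?thesis
    using True unfolding prod dirichlet_density_def
    by (simp add: power_kernel_def ennreal_mult[symmetric] mult_ac)
next
  case False
  then consider j where "j \<in> {1..<r}" "\<not> 0 < w j" | "\<not> (\<Sum>j\<in>{1..<r}. w j) < 1" by blast
  then have "(\<Prod>j\<in>{1..<r}. power_kernel (\<alpha> j) (w j)) = 0 \<or>
      power_kernel (\<alpha> r) (1 - (\<Sum>j\<in>{1..<r}. w j)) = 0"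
  proof cases
    case 1
    then have "(\<Prod>j\<in>{1..<r}. power_kernel (\<alpha> j) (w j)) = 0"
      by (intro prod_zero) (auto simp: power_kernel_def)
    then show ?thesis ..
  qed (simp add: power_kernel_def)
  then have "(\<Prod>j\<in>{1..<r}. power_kernel (\<alpha> j) (w j)) * power_kernel (\<alpha> r) (1 - (\<Sum>j\<in>{1..<r}. w j)) = 0"
    by (simp only: mult_eq_0_iff)
  moreover have "dirichlet_density r \<alpha> w = 0"
    using False unfolding dirichlet_density_def by (simp only: if_False)
  ultimately show ?thesis by (simp only: mult_zero_right ennreal_0)
qed

text \<open>The two-part instance of the same factorisation, through which the final kernel integral
  is recognised as a Beta law.\<close>

lemma beta_density_power_kernel:
  assumes "p > 0" "q > 0"
  shows "ennreal (beta_density p q z)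
    = ennreal (Gamma (p + q)) * (power_kernel p z * power_kernel q (1 - z))"
proof -
  have "Gamma (p + q) > 0" "Gamma p > 0" "Gamma q > 0" using assms by auto
  then show ?thesis
    by (auto simp: beta_density_def power_kernel_def ennreal_mult[symmetric])
qed

section \<open>The law of the randomly weighted average\<close>

theorem theorem2p1:
  fixes M :: "'a measure"
    and r :: nat
    and n m :: "nat \<Rightarrow> real"
    and X W :: "nat \<Rightarrow> 'a \<Rightarrow> real"
  assumes "prob_space M"
    and "r \<ge> 1"
    and "\<And>j. j \<in> {1..r} \<Longrightarrow> n j > 0"
    and "\<And>j. j \<in> {1..r} \<Longrightarrow> m j > 0"
    and "prob_space.indep_vars M (\<lambda>_. borel) X {1..r}"
    and "\<And>j. j \<in> {1..r} \<Longrightarrow>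
           distributed M lborel (X j) (\<lambda>x. ennreal (beta_density (n j) (m j) x))"
    and "dirichlet_distributed M r (\<lambda>j. n j + m j) W"
    and "prob_space.indep_var M
           (Pi\<^sub>M {1..r} (\<lambda>_. borel)) (\<lambda>\<omega>. \<lambda>j\<in>{1..r}. W j \<omega>)
           (Pi\<^sub>M {1..r} (\<lambda>_. borel)) (\<lambda>\<omega>. \<lambda>j\<in>{1..r}. X j \<omega>)"
  shows "distributed M lborel (\<lambda>\<omega>. \<Sum>j\<in>{1..r}. W j \<omega> * X j \<omega>)
           (\<lambda>x. ennreal (beta_density (\<Sum>j\<in>{1..r}. n j) (\<Sum>j\<in>{1..r}. m j) x))"
proof -
  interpret prob_space M by fact
  \<comment> \<open>\<open>R\<close> indexes the free Dirichlet coordinates; index \<open>r\<close>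
    is the dependent one and takes the role of \<open>p\<close>, \<open>q\<close> in the kernel
    lemma.\<close>
  define R where "R = {1..<r}"
  have rR: "{1..r} = insert r R" "r \<notin> R" "finite R" using assms(2) by (auto simp: R_def)
  define N where "N j = density lborel (\<lambda>x. ennreal (beta_density (n j) (m j) x))" for j
  have sets_N [measurable_cong]: "sets (N j) = sets borel" for j
    by (simp add: N_def)
  interpret N: product_sigma_finite N
    unfolding N_def[abs_def] by (rule product_sigma_finite_beta)
  define D where "D = (\<lambda>w. ennreal (dirichlet_density r (\<lambda>j. n j + m j) w))"
  define WR where "WR = (\<lambda>\<omega>. \<lambda>j\<in>R. W j \<omega>)"
  define XR where "XR = (\<lambda>\<omega>. \<lambda>j\<in>{1..r}. X j \<omega>)"
  define MW where "MW = Pi\<^sub>M R (\<lambda>_. lborel :: real measure)"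
  define MX where "MX = Pi\<^sub>M {1..r} (\<lambda>_. borel :: real measure)"
  define a b where "a = (\<Sum>j\<in>{1..r}. n j)" and "b = (\<Sum>j\<in>{1..r}. m j)"
  have pos: "a > 0" "b > 0"
    unfolding a_def b_def using assms(2-4) by (auto intro!: sum_pos)
  have ab: "a = n r + (\<Sum>j\<in>R. n j)" "b = m r + (\<Sum>j\<in>R. m j)"
    "(\<Sum>j\<in>{1..r}. n j + m j) = a + b"
    using rR by (simp_all add: a_def b_def sum.distrib)
  have W: "\<And>j. j \<in> {1..r} \<Longrightarrow> W j \<in> borel_measurable M"
    "AE \<omega> in M. (\<Sum>j\<in>{1..r}. W j \<omega>) = 1"
    "distributed M MW WR D"
    using assms(7) by (auto simp: dirichlet_distributed_def WR_def D_def R_def MW_def)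
  have X: "\<And>j. j \<in> {1..r} \<Longrightarrow> X j \<in> borel_measurable M"
    using assms(6) by (auto simp: distributed_def)
  have Z: "(\<lambda>\<omega>. \<Sum>j\<in>{1..r}. W j \<omega> * X j \<omega>) \<in> borel_measurable M"
    using W(1) X by auto
  have distr_W: "distr M MW WR = density MW D" and [measurable]: "D \<in> borel_measurable MW" "WR \<in> M \<rightarrow>\<^sub>M MW"
    using W(3) by (auto simp: distributed_def)
  have [measurable]: "XR \<in> M \<rightarrow>\<^sub>M MX"
    unfolding XR_def MX_def using X by (intro measurable_restrict) auto
  have distr_X: "distr M MX XR = Pi\<^sub>M {1..r} N"
  proof -
    have "distr M MX XR = Pi\<^sub>M {1..r} (\<lambda>j. distr M borel (X j))"
      using indep_vars_iff_distr_eq_PiM'[of "{1..r}" X "\<lambda>_. borel"] assms(2,5) X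
      by (auto simp: XR_def MX_def)
    also have "\<dots> = Pi\<^sub>M {1..r} N"
    proof (intro PiM_cong refl)
      fix j assume "j \<in> {1..r}"
      then have "distr M lborel (X j) = N j"
        using assms(6) by (auto simp: distributed_def N_def)
      moreover have "distr M lborel (X j) = distr M borel (X j)"
        by (rule distr_cong) auto
      ultimately show "distr M borel (X j) = N j" by simp
    qed
    finally show ?thesis .
  qed
  \<comment> \<open>Restricting the weight vector to \<open>R\<close> is a measurable map, so
    independence passes from the full vector to the part that has a density.\<close>
  have indep: "indep_var MW WR MX XR"
  proof -
    have "(\<lambda>w. restrict w R) \<in> Pi\<^sub>M {1..r} (\<lambda>_. borel) \<rightarrow>\<^sub>M MW"
      unfolding MW_def rR(1)
      by (intro measurable_restrict) auto
    from indep_var_compose[OF assms(8) this measurable_ident]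
    have "indep_var MW ((\<lambda>w. restrict w R) \<circ> (\<lambda>\<omega>. \<lambda>j\<in>{1..r}. W j \<omega>)) MX XR"
      by (simp add: MX_def XR_def comp_def)
    also have "(\<lambda>w. restrict w R) \<circ> (\<lambda>\<omega>. \<lambda>j\<in>{1..r}. W j \<omega>) = WR"
      by (auto simp: WR_def fun_eq_iff R_def)
    finally show ?thesis .
  qed
  have "distr M lborel (\<lambda>\<omega>. \<Sum>j\<in>{1..r}. W j \<omega> * X j \<omega>)
      = density lborel (\<lambda>x. ennreal (beta_density a b x))"
  proof (rule measure_eqI)
    fix A assume "A \<in> sets (distr M lborel (\<lambda>\<omega>. \<Sum>j\<in>{1..r}. W j \<omega> * X j \<omega>))"
    then have A [measurable]: "A \<in> sets borel" by simp
    \<comment> \<open>\<open>h\<close> replaces the last weight by one minus the others. This agrees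
      with the weighted average almost surely and involves only the free weights.\<close>
    define h :: "(nat \<Rightarrow> real) \<Rightarrow> (nat \<Rightarrow> real) \<Rightarrow> ennreal" where
      "h w x = indicator A ((\<Sum>j\<in>R. w j * x j) + (1 - (\<Sum>j\<in>R. w j)) * x r)" for w x
    have h [measurable]: "case_prod h \<in> borel_measurable (MW \<Otimes>\<^sub>M MX)"
      unfolding h_def MW_def MX_def rR(1) by measurable
    interpret XP: prob_space "distr M MX XR" by (rule prob_space_distr) simp
    have "emeasure (distr M lborel (\<lambda>\<omega>. \<Sum>j\<in>{1..r}. W j \<omega> * X j \<omega>)) A
        = (\<integral>\<^sup>+\<omega>. indicator A (\<Sum>j\<in>{1..r}. W j \<omega> * X j \<omega>) \<partial>M)"
      using Z by (subst nn_integral_distr[where M' = lborel, symmetric]) auto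
    also have "\<dots> = (\<integral>\<^sup>+\<omega>. h (WR \<omega>) (XR \<omega>) \<partial>M)"
    proof (rule nn_integral_cong_AE)
      show "AE \<omega> in M. indicator A (\<Sum>j\<in>{1..r}. W j \<omega> * X j \<omega>) = h (WR \<omega>) (XR \<omega>)"
        using W(2)
      proof eventually_elim
        case (elim \<omega>)
        have "W r \<omega> = 1 - (\<Sum>j\<in>R. W j \<omega>)"
          using elim rR by (simp add: algebra_simps)
        then show ?case
          using rR by (simp add: h_def WR_def XR_def add_ac)
      qed
    qed
    also have "\<dots> = (\<integral>\<^sup>+p. case_prod h p \<partial>distr M (MW \<Otimes>\<^sub>M MX) (\<lambda>\<omega>. (WR \<omega>, XR \<omega>)))"
      by (subst nn_integral_distr) auto
    also have "\<dots> = (\<integral>\<^sup>+p. case_prod h p \<partial>(distr M MW WR \<Otimes>\<^sub>M distr M MX XR))"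
      using indep by (simp add: indep_var_distribution_eq)
    also have "\<dots> = (\<integral>\<^sup>+w. \<integral>\<^sup>+x. h w x \<partial>distr M MX XR \<partial>distr M MW WR)"
      by (subst XP.nn_integral_fst[symmetric]) auto
    also have "\<dots> = (\<integral>\<^sup>+w. D w * (\<integral>\<^sup>+x. h w x \<partial>distr M MX XR) \<partial>MW)"
      unfolding distr_W by (rule nn_integral_density) measurable
    \<comment> \<open>This is the form of \<open>beta_weighted_sum_kernel\<close> at
      \<open>p = n r\<close>, \<open>q = m r\<close>, \<open>s = 1\<close>, \<open>t = 0\<close>,
      whence the summand 0. The variable at \<open>r\<close> is integrated separately as
      \<open>y\<close>.\<close>
    also have "\<dots> = (\<integral>\<^sup>+w. ennreal (Gamma (a + b)) * (\<integral>\<^sup>+x. (\<Prod>j\<in>R. power_kernel (n j + m j) (w j)) *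
        (power_kernel (n r + m r) (1 - (\<Sum>j\<in>R. w j)) *
          (\<integral>\<^sup>+y. ennreal (beta_density (n r) (m r) y) *
             indicator A (0 + (\<Sum>j\<in>R. w j * x j) + (1 - (\<Sum>j\<in>R. w j)) * y) \<partial>lborel))
        \<partial>Pi\<^sub>M R N) \<partial>MW)"
    proof (rule nn_integral_cong)
      fix w assume w: "w \<in> space MW"
      have [measurable]: "h w \<in> borel_measurable (Pi\<^sub>M (insert r R) N)"
        unfolding h_def by measurable
      have Dw: "D w = ennreal (Gamma (a + b)) *
          ((\<Prod>j\<in>R. power_kernel (n j + m j) (w j)) * power_kernel (n r + m r) (1 - (\<Sum>j\<in>R. w j)))"
        unfolding D_def R_def using assms(2-4)
        by (subst dirichlet_density_power_kernel) (auto simp: ab(3)[simplified] add_pos_pos)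
      have "(\<integral>\<^sup>+x. h w x \<partial>distr M MX XR) = (\<integral>\<^sup>+x. \<integral>\<^sup>+y. h w (x(r := y)) \<partial>N r \<partial>Pi\<^sub>M R N)"
        unfolding distr_X unfolding rR(1) by (rule N.product_nn_integral_insert) (auto simp: rR)
      also have "\<dots> = (\<integral>\<^sup>+x. \<integral>\<^sup>+y. ennreal (beta_density (n r) (m r) y) *
             indicator A (0 + (\<Sum>j\<in>R. w j * x j) + (1 - (\<Sum>j\<in>R. w j)) * y) \<partial>lborel \<partial>Pi\<^sub>M R N)"
      proof (rule nn_integral_cong)
        fix x
        have "(\<Sum>j\<in>R. w j * (x(r := y)) j) = (\<Sum>j\<in>R. w j * x j)" for y
          using rR by (intro sum.cong) auto
        then show "(\<integral>\<^sup>+y. h w (x(r := y)) \<partial>N r) = (\<integral>\<^sup>+y. ennreal (beta_density (n r) (m r) y) *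
             indicator A (0 + (\<Sum>j\<in>R. w j * x j) + (1 - (\<Sum>j\<in>R. w j)) * y) \<partial>lborel)"
          unfolding N_def h_def by (subst nn_integral_density) auto
      qed
      finally show "D w * (\<integral>\<^sup>+x. h w x \<partial>distr M MX XR) = ennreal (Gamma (a + b)) *
        (\<integral>\<^sup>+x. (\<Prod>j\<in>R. power_kernel (n j + m j) (w j)) *
        (power_kernel (n r + m r) (1 - (\<Sum>j\<in>R. w j)) *
          (\<integral>\<^sup>+y. ennreal (beta_density (n r) (m r) y) *
             indicator A (0 + (\<Sum>j\<in>R. w j * x j) + (1 - (\<Sum>j\<in>R. w j)) * y) \<partial>lborel))
        \<partial>Pi\<^sub>M R N)"
        unfolding Dw by (simp add: nn_integral_cmult mult.assoc)
    qed
    also have "\<dots> = ennreal (Gamma (a + b)) * (\<integral>\<^sup>+w. (\<integral>\<^sup>+x. (\<Prod>j\<in>R. power_kernel (n j + m j) (w j)) *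
        (power_kernel (n r + m r) (1 - (\<Sum>j\<in>R. w j)) *
          (\<integral>\<^sup>+y. ennreal (beta_density (n r) (m r) y) *
             indicator A (0 + (\<Sum>j\<in>R. w j * x j) + (1 - (\<Sum>j\<in>R. w j)) * y) \<partial>lborel))
        \<partial>Pi\<^sub>M R N) \<partial>MW)"
      unfolding MW_def
      by (intro nn_integral_cmult sigma_finite_measure.borel_measurable_nn_integral
          N.sigma_finite rR(3)) measurable
    \<comment> \<open>The merged first parts have total parameter \<open>a\<close>, the merged
      second parts \<open>b\<close>, and the total mass is 1.\<close>
    also have "\<dots> = ennreal (Gamma (a + b)) *
        (\<integral>\<^sup>+z. power_kernel a z * (power_kernel b (1 - z) * indicator A (0 + z)) \<partial>lborel)"
      unfolding MW_def N_def ab(1,2) using assms(2-4)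
      by (subst beta_weighted_sum_kernel) (auto simp: R_def)
    also have "\<dots> = (\<integral>\<^sup>+z. ennreal (beta_density a b z) * indicator A z \<partial>lborel)"
      by (simp add: beta_density_power_kernel pos nn_integral_cmult[symmetric] mult.assoc)
    also have "\<dots> = emeasure (density lborel (\<lambda>x. ennreal (beta_density a b x))) A"
      by (simp add: emeasure_density)
    finally show "emeasure (distr M lborel (\<lambda>\<omega>. \<Sum>j\<in>{1..r}. W j \<omega> * X j \<omega>)) A
      = emeasure (density lborel (\<lambda>x. ennreal (beta_density a b x))) A" .
  qed simp
  then show ?thesis
    using Z unfolding distributed_def a_def b_def by simp
qed

end
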